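(* Let $A$ be an idiom and $d$ an inflator on $A$. Put $\mathcal{T}_d=[d]_t$, the $\sim_t$-equivalence class of $d$. Then $[d]_t$ is the interval $$[d]_t=\Big[\bigwedge\mathcal{T}_d,\ \bigvee\mathcal{T}_d\Big]$$ of the lattice $I(A)$. Moreover, there is a bijective correspondence between $\mathrm{Tot}(I(A))$ and the set of these intervals (that is, the set of all classes $[d]_t$, $d\in I(A)$).
   Context: An idiom is a complete modular lattice $A$ with top $\bar{1}$ and bottom $\underline{0}$ that is meet-continuous: $a\wedge\bigvee X=\bigvee\{a\wedge x\mid x\in X\}$ for all $a\in A$ and all directed $X\subseteq A$. An inflator on $A$ is a monotone map $d\colon A\to A$ with $a\le d(a)$ for all $a\in A$. $I(A)$ is the set of all inflators, ordered pointwise; it is a complete lattice in which infima, and suprema of non-empty families, are computed pointwise. Its top is $\bar{d}$, where $\bar{d}(a)=\bar{1}$ for all $a$. The product of inflators is composition: $(zd)(a)=z(d(a))$. The totalizer of $d\in I(A)$ is $t(d)=\bigwedge\{z\in I(A)\mid zd=\bar{d}\}$. For $b\in A$, the inflator $O_b$ is defined by $O_b(a)=\bar{1}$ if $a\ge b$, and $O_b(a)=a$ otherwise. $\mathrm{Tot}(I(A))$ is the set of all totalizers, i.e. of all inflators of the form $O_{d(\underline{0})}$ with $d\in I(A)$ (one has $t(d)=O_{d(\underline{0})}$). The equivalence relation $\sim_t$ on $I(A)$ is: $d\sim_t d'$ if and only if $t(d)=t(d')$; $[d]_t$ is the class of $d$. *)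

theory Defs
  imports Main
begin

class idiom = complete_lattice +
  assumes modular: "a \<le> c \<Longrightarrow> sup a (inf b c) = inf (sup a b) c"
    and meet_continuous:
      "X \<noteq> {} \<Longrightarrow> (\<And>x y. x \<in> X \<Longrightarrow> y \<in> X \<Longrightarrow> \<exists>z\<in>X. x \<le> z \<and> y \<le> z) \<Longrightarrow>
        inf a (Sup X) = Sup ((\<lambda>x. inf a x) ` X)"

typedef (overloaded) 'a inflator =
  "{d :: 'a::idiom \<Rightarrow> 'a. mono d \<and> (\<forall>a. a \<le> d a)}"
  morphisms apply_inflator Inflator
proof
  show "(\<lambda>a. a) \<in> {d :: 'a \<Rightarrow> 'a. mono d \<and> (\<forall>a. a \<le> d a)}"
    by (simp add: mono_def)
qed

setup_lifting type_definition_inflator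

text \<open>The lattice \<open>I(A)\<close>. Its least element is the identity, so the pointwise supremum
  is joined with the identity; this matters only for the supremum of the empty family
  (see \<open>apply_Sup_nonempty\<close>).\<close>

instantiation inflator :: (idiom) complete_lattice
begin

lift_definition less_eq_inflator :: "'a inflator \<Rightarrow> 'a inflator \<Rightarrow> bool"
  is "\<lambda>d e. \<forall>a. d a \<le> e a" .

definition less_inflator :: "'a inflator \<Rightarrow> 'a inflator \<Rightarrow> bool"
  where "less_inflator d e \<longleftrightarrow> d \<le> e \<and> \<not> e \<le> d"

lift_definition inf_inflator :: "'a inflator \<Rightarrow> 'a inflator \<Rightarrow> 'a inflator"
  is "\<lambda>d e a. inf (d a) (e a)"
  by (auto simp: mono_def intro: le_infI1 le_infI2)

lift_definition sup_inflator :: "'a inflator \<Rightarrow> 'a inflator \<Rightarrow> 'a inflator"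
  is "\<lambda>d e a. sup (d a) (e a)"
  by (auto simp: mono_def intro: le_supI1 le_supI2)

lift_definition top_inflator :: "'a inflator" is "\<lambda>a. top"
  by (simp add: mono_def)

lift_definition bot_inflator :: "'a inflator" is "\<lambda>a. a"
  by (simp add: mono_def)

lift_definition Inf_inflator :: "'a inflator set \<Rightarrow> 'a inflator"
  is "\<lambda>D a. INF d\<in>D. d a"
  by (fastforce simp: mono_def intro: INF_greatest INF_mono)

lift_definition Sup_inflator :: "'a inflator set \<Rightarrow> 'a inflator"
  is "\<lambda>D a. sup a (SUP d\<in>D. d a)"
  by (auto simp: mono_def intro: le_supI1) (blast intro: le_supI2 SUP_mono)

instance
proof
  fix d e f :: "'a inflator" and D :: "'a inflator set"
  show "d < e \<longleftrightarrow> d \<le> e \<and> \<not> e \<le> d" by (rule less_inflator_def)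
  show "d \<le> d" by transfer simp
  show "d \<le> e \<Longrightarrow> e \<le> f \<Longrightarrow> d \<le> f" by transfer (blast intro: order_trans)
  show "d \<le> e \<Longrightarrow> e \<le> d \<Longrightarrow> d = e" by transfer (auto intro: order_antisym)
  show "inf d e \<le> d" "inf d e \<le> e" by (transfer, simp)+
  show "d \<le> e \<Longrightarrow> d \<le> f \<Longrightarrow> d \<le> inf e f" by transfer simp
  show "d \<le> sup d e" "e \<le> sup d e" by (transfer, simp)+
  show "e \<le> d \<Longrightarrow> f \<le> d \<Longrightarrow> sup e f \<le> d" by transfer simp
  show "d \<in> D \<Longrightarrow> Inf D \<le> d" by transfer (auto intro: INF_lower)
  show "(\<And>e. e \<in> D \<Longrightarrow> d \<le> e) \<Longrightarrow> d \<le> Inf D" by transfer (auto intro: INF_greatest)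
  show "d \<in> D \<Longrightarrow> d \<le> Sup D" by transfer (auto intro: le_supI2 SUP_upper)
  show "(\<And>e. e \<in> D \<Longrightarrow> e \<le> d) \<Longrightarrow> Sup D \<le> d" by transfer (auto intro: SUP_least)
  show "Inf ({} :: 'a inflator set) = top" by transfer simp
  show "Sup ({} :: 'a inflator set) = bot" by transfer simp
qed

end

lemma apply_Sup_nonempty:
  fixes D :: "'a::idiom inflator set"
  assumes "D \<noteq> {}"
  shows "apply_inflator (Sup D) a = (SUP d\<in>D. apply_inflator d a)"
  using assms
proof -
  from assms obtain d where "d \<in> D" by blast
  moreover have "a \<le> apply_inflator d a" using apply_inflator[of d] by simp
  ultimately have "a \<le> (SUP d\<in>D. apply_inflator d a)" by (rule SUP_upper2)
  then show ?thesis by (simp add: Sup_inflator.rep_eq image_image sup_absorb2)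
qed

lift_definition inflator_prod :: "'a::idiom inflator \<Rightarrow> 'a inflator \<Rightarrow> 'a inflator"
    (infixl "\<odot>" 70)
  is "\<lambda>z d a. z (d a)"
  by (auto simp: mono_def intro: order_trans)

definition totalizer :: "'a::idiom inflator \<Rightarrow> 'a inflator"
  where "totalizer d = Inf {z. z \<odot> d = top}"

definition Tot :: "'a::idiom inflator set"
  where "Tot = range totalizer"

definition tot_rel :: "('a::idiom inflator \<times> 'a inflator) set"
  where "tot_rel = {(d, e). totalizer d = totalizer e}"

definition tot_class :: "'a::idiom inflator \<Rightarrow> 'a inflator set"
  where "tot_class d = tot_rel `` {d}"

lift_definition O_inflator :: "'a::idiom \<Rightarrow> 'a inflator"
  is "\<lambda>b a. if b \<le> a then top else a"
  by (auto simp: mono_def intro: order_trans)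

lemma totalizer_eq_O: "totalizer d = O_inflator (apply_inflator d bot)"
proof (rule order_antisym)
  have "O_inflator (apply_inflator d bot) \<odot> d = top"
    by transfer (auto simp: fun_eq_iff mono_def)
  then show "totalizer d \<le> O_inflator (apply_inflator d bot)"
    unfolding totalizer_def by (intro Inf_lower) simp
  show "O_inflator (apply_inflator d bot) \<le> totalizer d"
    unfolding totalizer_def
  proof (rule Inf_greatest)
    fix z assume "z \<in> {z. z \<odot> d = top}"
    then have "z \<odot> d = top" by simp
    then show "O_inflator (apply_inflator d bot) \<le> z"
      by transfer (auto simp: fun_eq_iff mono_def, metis top_le)
  qed
qed

lemma Tot_eq_O: "Tot = range (\<lambda>d. O_inflator (apply_inflator d bot))"
  by (simp add: Tot_def totalizer_eq_O)

end

theory Submission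
  imports Defs
begin

text \<open>The totalizer of \<open>d\<close> is \<open>O\<^sub>b\<close> for \<open>b = d(\<bottom>)\<close>, and \<open>O\<^sub>b\<close> determines \<open>b\<close>. Two inflators
  therefore have the same totalizer iff they agree at \<open>\<bottom>\<close>, so each class is a fibre of the
  evaluation map \<open>d \<mapsto> d(\<bottom>)\<close> on \<open>I(A)\<close>. Since infima and suprema of nonempty families of
  inflators are pointwise, evaluation preserves them. A fibre thus contains its own infimum and
  supremum, and monotonicity of evaluation forces everything between them into the fibre; this is
  the interval claim. The bijection is formal: \<open>\<sim>\<^sub>t\<close> is the kernel of \<open>d \<mapsto> t(d)\<close>, so the values
  of that map correspond to its fibres.\<close>

text \<open>Equal \<open>O\<^sub>b\<close> and \<open>O\<^sub>c\<close> are compared at the points \<open>b\<close> and \<open>c\<close>. If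
  \<open>\<not> c \<le> b\<close>, then \<open>O\<^sub>c(b) = b\<close> while \<open>O\<^sub>b(b) = \<top>\<close>; equality would give \<open>b = \<top>\<close>, contradicting
  \<open>\<not> c \<le> b\<close>.\<close>

lemma O_inflator_eq_iff: "O_inflator b = O_inflator c \<longleftrightarrow> b = c"
proof
  have le: "c' \<le> b'" if "O_inflator b' = O_inflator c'" for b' c' :: 'a
  proof (rule ccontr)
    assume "\<not> c' \<le> b'"
    moreover have "apply_inflator (O_inflator b') b' = apply_inflator (O_inflator c') b'"
      using that by simp
    ultimately have "b' = top" by (simp add: O_inflator.rep_eq)
    with \<open>\<not> c' \<le> b'\<close> show False by simp
  qed
  assume "O_inflator b = O_inflator c"
  then show "b = c" using le[of b c] le[of c b] by (simp add: order_antisym)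
qed simp

lemma totalizer_eq_iff:
  "totalizer d = totalizer e \<longleftrightarrow> apply_inflator d bot = apply_inflator e bot"
  by (simp add: totalizer_eq_O O_inflator_eq_iff)

lemma tot_class_iff_apply_bot:
  "e \<in> tot_class d \<longleftrightarrow> apply_inflator e bot = apply_inflator d bot"
  by (auto simp: tot_class_def tot_rel_def totalizer_eq_iff)

lemma tot_class_eq_vimage: "tot_class d = totalizer -` {totalizer d}"
  by (auto simp: tot_class_def tot_rel_def)

text \<open>Evaluation at \<open>\<bottom>\<close> is constant on the class, and the class is nonempty, so the pointwise
  infimum and supremum take that same constant value at \<open>\<bottom>\<close>.\<close>

lemma tot_class_closed_Inf_Sup:
  shows Inf_in_tot_class: "Inf (tot_class d) \<in> tot_class d"
    and Sup_in_tot_class: "Sup (tot_class d) \<in> tot_class d"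
proof -
  have ne: "tot_class d \<noteq> {}" using tot_class_iff_apply_bot by blast
  show "Inf (tot_class d) \<in> tot_class d"
    by (simp add: tot_class_iff_apply_bot Inf_inflator.rep_eq image_image ne)
  show "Sup (tot_class d) \<in> tot_class d"
    by (simp add: tot_class_iff_apply_bot apply_Sup_nonempty[OF ne] ne)
qed

lemma tot_class_eq_interval: "tot_class d = {Inf (tot_class d)..Sup (tot_class d)}"
proof (intro equalityI subsetI)
  fix e assume "e \<in> tot_class d"
  then show "e \<in> {Inf (tot_class d)..Sup (tot_class d)}"
    by (simp add: Inf_lower Sup_upper)
next
  fix e assume "e \<in> {Inf (tot_class d)..Sup (tot_class d)}"
  then have "apply_inflator (Inf (tot_class d)) bot \<le> apply_inflator e bot"
    and "apply_inflator e bot \<le> apply_inflator (Sup (tot_class d)) bot"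
    by (auto simp: less_eq_inflator.rep_eq)
  with tot_class_closed_Inf_Sup[of d] show "e \<in> tot_class d"
    by (simp add: tot_class_iff_apply_bot order_antisym)
qed

lemma bij_betw_vimage_Tot_classes:
  "bij_betw (\<lambda>t. totalizer -` {t}) (Tot :: 'a::idiom inflator set) (UNIV // tot_rel)"
proof (rule bij_betw_imageI)
  show "inj_on (\<lambda>t. totalizer -` {t}) (Tot :: 'a inflator set)"
    by (auto simp: inj_on_def Tot_def)
  have "UNIV // tot_rel = range (tot_class :: 'a inflator \<Rightarrow> _)"
    by (auto simp: quotient_def tot_class_def)
  then show "(\<lambda>t. totalizer -` {t}) ` (Tot :: 'a inflator set) = UNIV // tot_rel"
    by (simp add: Tot_def tot_class_eq_vimage image_image)
qed

theorem proposition3p7: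
  fixes d :: "'a::idiom inflator"
  shows "tot_class d = {Inf (tot_class d)..Sup (tot_class d)} \<and>
    (\<exists>f. bij_betw f (Tot :: 'a inflator set) (UNIV // tot_rel) \<and>
      (\<forall>e. f (totalizer e) = tot_class e))"
  using tot_class_eq_interval bij_betw_vimage_Tot_classes tot_class_eq_vimage by blast

end
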